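(* Let $s\ge 2$, $k\ge1$, $0\le t\le k$, $\lambda\ge1$ be integers. Each one of the distinct inequalities among the $s^k$ inequalities defining $\mathrm{OAP}(k,s,t,\lambda)$ (one for each $\mathbf u\in[s]^k$: the inequality $N_{\mathbf u}\ge0$ if $d(\mathbf 1,\mathbf u)>t$, and the inequality indexed by $\mathbf x=\mathbf u$ below if $d(\mathbf 1,\mathbf u)\le t$) defines a facet of $\mathrm{OAP}(k,s,t,\lambda)$, and no facet is repeated (i.e. these $s^k$ inequalities define pairwise distinct facets) unless $k=t+1$ and $s=2$.
   Context: Let $\{a_c\}$ be defined by $a_0=\lambda$, $a_c=\lambda-\sum_{e=0}^{c-1}a_e\binom{k-t}{c-e}(s-1)^{c-e}$ for $c\ge1$. Write $[s]=\{1,\dots,s\}$, $\mathbf 1=(1,\dots,1)\in[s]^k$, and $d(\mathbf u,\mathbf v)$ for the Hamming distance on $[s]^k$. For $\mathbf x\in[s]^k$ let $I_{\mathbf x}=\{i:x_i\ne1\}$, $J_{\mathbf x}=\{\mathbf y\in[s]^k: y_i=x_i\ \forall i\in I_{\mathbf x}\}$. Let $m=\sum_{i=t+1}^k\binom{k}{i}(s-1)^i$. The LP relaxation orthogonal array polytope $\mathrm{OAP}(k,s,t,\lambda)\subseteq\mathbb R^m$ is the set of real vectors $(N_{\mathbf y})$, indexed by $\mathbf y\in[s]^k$ with $d(\mathbf 1,\mathbf y)\ge t+1$, satisfying $N_{\mathbf y}\ge0$ for all such $\mathbf y$ and, for every $\mathbf x\in[s]^k$ with $0\le d(\mathbf 1,\mathbf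 x)\le t$, $a_{t-d(\mathbf 1,\mathbf x)}+(-1)^{t-d(\mathbf 1,\mathbf x)+1}\sum_{\mathbf y\in J_{\mathbf x},\,d(\mathbf 1,\mathbf y)>t}\binom{d(\mathbf 1,\mathbf y)-d(\mathbf 1,\mathbf x)-1}{t-d(\mathbf 1,\mathbf x)}N_{\mathbf y}\ge0$.
   Formalization: Pairwise distinctness of the facets is claimed only for t < k: at t = k the polytope is a single point and all s^k inequalities read λ ≥ 0, so they all define the same (empty) face, which is counted as a facet of the point. *)

theory Defs
  imports "HOL-Analysis.Analysis"
begin

text \<open>
  The words \<open>[s]\<^sup>k\<close> are the vectors of type \<^typ>\<open>'s ^ 'k\<close>, where \<open>s = CARD('s)\<close> and
  \<open>k = CARD('k)\<close>. The alphabet is an arbitrary finite type with a distinguished symbol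
  \<open>1\<close>, so that \<open>1 :: 's ^ 'k\<close> is the all-ones word.
\<close>

definition hamming :: "'s ^ 'k \<Rightarrow> 's ^ 'k \<Rightarrow> nat" where
  "hamming u v = card {i. u $ i \<noteq> v $ i}"

fun oa_coeff :: "nat \<Rightarrow> nat \<Rightarrow> nat \<Rightarrow> nat \<Rightarrow> nat \<Rightarrow> real" where
  "oa_coeff k s t lam 0 = real lam"
| "oa_coeff k s t lam (Suc c) =
     real lam - (\<Sum>e = 0..c. oa_coeff k s t lam e * real ((k - t) choose (Suc c - e))
                               * (real s - 1) ^ (Suc c - e))"

definition supp_set :: "('s::one) ^ 'k \<Rightarrow> 'k set" where
  "supp_set x = {i. x $ i \<noteq> 1}"

definition ext_set :: "('s::one) ^ 'k \<Rightarrow> ('s ^ 'k) set" where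
  "ext_set x = {y. \<forall>i\<in>supp_set x. y $ i = x $ i}"

text \<open>
  The left-hand side of the inequality \<open>\<dots> \<ge> 0\<close> attached to the word \<open>u\<close>. In the second
  branch the summation index satisfies \<open>hamming 1 y > t \<ge> hamming 1 u\<close>, so none of the
  subtractions on natural numbers truncates.
\<close>

definition oa_lhs ::
  "nat \<Rightarrow> nat \<Rightarrow> ('s::{finite,one}) ^ ('k::finite) \<Rightarrow> real ^ ('s ^ 'k) \<Rightarrow> real" where
  "oa_lhs t lam u N =
     (if hamming 1 u > t then N $ u
      else oa_coeff CARD('k) CARD('s) t lam (t - hamming 1 u)
           + (- 1) ^ (t - hamming 1 u + 1)
             * (\<Sum>y \<in> {y \<in> ext_set u. hamming 1 y > t}.
                  real ((hamming 1 y - hamming 1 u - 1) choose (t - hamming 1 u)) * N $ y))"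

text \<open>
  The space \<open>\<real>\<^sup>m\<close> of vectors indexed by the words at distance at least \<open>t + 1\<close> from \<open>1\<close>
  is realised as the coordinate subspace of \<^typ>\<open>real ^ ('s ^ 'k)\<close> on which all other
  coordinates vanish. This is the zero space if \<open>t = CARD('k)\<close>.
\<close>

definition oa_space :: "nat \<Rightarrow> (real ^ (('s::{finite,one}) ^ ('k::finite))) set" where
  "oa_space t = {N. \<forall>y. hamming 1 y \<le> t \<longrightarrow> N $ y = 0}"

definition OAP :: "nat \<Rightarrow> nat \<Rightarrow> (real ^ (('s::{finite,one}) ^ ('k::finite))) set" where
  "OAP t lam = {N \<in> oa_space t. \<forall>u. oa_lhs t lam u N \<ge> 0}"

definition OAP_face ::
  "nat \<Rightarrow> nat \<Rightarrow> ('s::{finite,one}) ^ ('k::finite) \<Rightarrow> (real ^ ('s ^ 'k)) set" where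
  "OAP_face t lam u = {N \<in> OAP t lam. oa_lhs t lam u N = 0}"

text \<open>
  A facet is a face of codimension one. Unlike the library's \<open>facet_of\<close>, this admits
  the empty set (of dimension \<open>-1\<close>) as the facet of a single point; in every other case
  the two notions agree.
\<close>

definition is_facet_of :: "'a::euclidean_space set \<Rightarrow> 'a set \<Rightarrow> bool" where
  "is_facet_of F P \<longleftrightarrow> F face_of P \<and> aff_dim F = aff_dim P - 1"

lemma is_facet_of_iff_facet_of:
  assumes "aff_dim P \<noteq> 0"
  shows "is_facet_of F P \<longleftrightarrow> F facet_of P"
  using assms by (auto simp: is_facet_of_def facet_of_def)

end

theory Submission
  imports Defs
begin

text \<open>
  An array \<open>N\<close> on all of \<open>[s]\<^sup>k\<close> whose \<open>t\<close>-marginals all equal \<open>\<lambda>\<close> is determined by its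
  entries \<open>N y\<close> with \<open>d(1, y) > t\<close>: inclusion-exclusion over the marginals of \<open>N\<close> gives the
  left-hand side at \<open>u\<close> of the inequalities of the polytope as the entry \<open>N u\<close>. So it suffices
  to find, for each \<open>u\<close>, such an array that vanishes at \<open>u\<close> and is positive elsewhere; the
  uniform array supplies an interior point. Let \<open>g i v = 1\<close> if \<open>v i = u i\<close> and
  \<open>g i v = - 1 / (s - 1)\<close> otherwise. For \<open>|T| > t\<close> the product of the \<open>g i\<close> over \<open>i \<in> T\<close> has
  zero \<open>t\<close>-marginals, is \<open>1\<close> at \<open>u\<close>, and at most \<open>1\<close> in absolute value. Subtracting from the
  uniform array a multiple of this product for \<open>T = [k]\<close> (if \<open>k = t + 1\<close>) or of its average
  over \<open>[k]\<close> and all \<open>[k] - {i}\<close> (if \<open>k > t + 1\<close>) gives the required array, except when \<open>s = 2\<close>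
  and \<open>k = t + 1\<close>; in that case the polytope is a segment.
\<close>

section \<open>The coefficients\<close>

text \<open>With K = k - t, the recursion says that the generating function of the coefficients
  times (1 + (s - 1) z)^K is lam / (1 - z). Hence, up to the factor lam, they are the partial sums
  of the coefficients of (1 + (s - 1) z)^(-K).\<close>

lemma oa_coeff_closed_form:
  "oa_coeff k s t lam c =
     real lam * (\<Sum>q\<le>c. (- real (k - t) gchoose q) * (real s - 1) ^ q)"
proof -
  define \<sigma> where "\<sigma> = real s - 1"
  define K where "K = k - t"
  define \<delta> where "\<delta> q = (- real K gchoose q) * \<sigma> ^ q" for q
  define A where "A c = (\<Sum>q\<le>c. \<delta> q)" for c
  define H where "H i = real (K choose i) * \<sigma> ^ i" for i
  \<comment> \<open>\<open>\<delta>\<close> and \<open>H\<close> are the coefficients of mutually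
    inverse power series; this is Vandermonde with upper indices -K and K.\<close>
  have conv: "(\<Sum>q\<le>c. \<delta> q * H (c - q)) = (if c = 0 then 1 else 0)" for c
  proof -
    have "(\<Sum>q\<le>c. \<delta> q * H (c - q)) =
          (\<Sum>q\<le>c. ((- real K gchoose q) * (real K gchoose (c - q))) * \<sigma> ^ c)"
      by (intro sum.cong)
         (auto simp: \<delta>_def H_def binomial_gbinomial simp flip: power_add)
    also have "\<dots> = (0 gchoose c) * \<sigma> ^ c"
      using gbinomial_Vandermonde[of "- real K" "real K" c]
      by (simp add: atMost_atLeast0 flip: sum_distrib_right)
    finally show ?thesis by (cases c) auto
  qed
  have A_conv: "(\<Sum>e\<le>c. A e * H (c - e)) = 1" for c
  proof (induction c)
    case 0
    then show ?case using conv[of 0] by (simp add: A_def)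
  next
    case (Suc c)
    have "(\<Sum>e\<le>Suc c. A e * H (Suc c - e)) = A 0 * H (Suc c) + (\<Sum>e\<le>c. A (Suc e) * H (c - e))"
      by (subst sum.atMost_Suc_shift) simp
    also have "\<dots> = (\<Sum>e\<le>c. A e * H (c - e)) + (\<delta> 0 * H (Suc c) + (\<Sum>e\<le>c. \<delta> (Suc e) * H (c - e)))"
      by (simp add: A_def distrib_right sum.distrib)
    also have "\<delta> 0 * H (Suc c) + (\<Sum>e\<le>c. \<delta> (Suc e) * H (c - e)) = (\<Sum>q\<le>Suc c. \<delta> q * H (Suc c - q))"
      by (subst sum.atMost_Suc_shift) simp
    finally show ?case using Suc conv[of "Suc c"] by simp
  qed
  have "oa_coeff k s t lam c = real lam * A c"
  proof (induction c rule: less_induct)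
    case (less c)
    show ?case
    proof (cases c)
      case 0
      then show ?thesis by (simp add: A_def \<delta>_def)
    next
      case (Suc c')
      have "oa_coeff k s t lam (Suc c') = real lam - (\<Sum>e\<le>c'. real lam * (A e * H (Suc c' - e)))"
        using less Suc
        by (auto simp: H_def K_def \<sigma>_def atMost_atLeast0 mult_ac intro!: sum.cong)
      also have "\<dots> = real lam - real lam * (\<Sum>e\<le>c'. A e * H (Suc c' - e))"
        by (simp add: sum_distrib_left)
      also have "(\<Sum>e\<le>c'. A e * H (Suc c' - e)) = 1 - A (Suc c')"
        using A_conv[of "Suc c'"] by (simp add: H_def)
      finally show ?thesis using Suc by (simp add: algebra_simps)
    qed
  qed
  then show ?thesis by (simp add: A_def \<delta>_def K_def \<sigma>_def)
qed

text \<open>Passes from powers of s - 1, as in the coefficients, to powers of s, as in the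
  marginals. After expanding (y - 1)^q and swapping the sums, trinomial revision turns the inner sum
  into an alternating partial sum of binomials, which has a closed form.\<close>

lemma gbinomial_partial_sum_shift:
  fixes x y :: "'a::field_char_0"
  shows "(\<Sum>q\<le>r. (- x gchoose q) * (y - 1) ^ q) =
         (\<Sum>p\<le>r. (- x gchoose p) * (x + of_nat r gchoose (r - p)) * y ^ p)"
proof -
  have "(\<Sum>q\<le>r. (- x gchoose q) * (y - 1) ^ q) =
        (\<Sum>q\<le>r. \<Sum>p\<le>q. (- x gchoose q) * (of_nat q gchoose p) * (- 1) ^ (q - p) * y ^ p)"
    using binomial_ring[of y "- 1"]
    by (intro sum.cong) (auto simp: sum_distrib_left binomial_gbinomial mult_ac)
  also have "\<dots> = (\<Sum>p\<le>r. \<Sum>q=p..r. (- x gchoose q) * (of_nat q gchoose p) * (- 1) ^ (q - p) * y ^ p)"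
    by (simp add: sum.Sigma) (rule sum.reindex_bij_witness[of _ prod.swap prod.swap]; auto)
  also have "\<dots> = (\<Sum>p\<le>r. (- x gchoose p) * (x + of_nat r gchoose (r - p)) * y ^ p)"
  proof (intro sum.cong refl)
    fix p assume "p \<in> {..r}"
    then have p: "p \<le> r" by simp
    have "(\<Sum>q=p..r. (- x gchoose q) * (of_nat q gchoose p) * (- 1) ^ (q - p) * y ^ p) =
          (\<Sum>q=p..r. ((- x gchoose p) * y ^ p) * ((- x - of_nat p gchoose (q - p)) * (- 1) ^ (q - p)))"
      by (intro sum.cong) (auto simp: gbinomial_trinomial_revision)
    also have "\<dots> = ((- x gchoose p) * y ^ p) *
        (\<Sum>j\<le>r - p. (- x - of_nat p gchoose j) * (- 1) ^ j)"
      unfolding sum_distrib_left[symmetric]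
      by (intro arg_cong2[where f = "(*)"] refl sum.reindex_bij_witness[of _ "\<lambda>j. j + p" "\<lambda>q. q - p"])
         (use p in auto)
    also have "(\<Sum>j\<le>r - p. (- x - of_nat p gchoose j) * (- 1) ^ j) = (x + of_nat r gchoose (r - p))"
      using p by (subst gbinomial_sum_lower_neg, subst gbinomial_negated_upper)
        (simp add: add.commute flip: mult.assoc power_add)
    finally show "(\<Sum>q=p..r. (- x gchoose q) * (of_nat q gchoose p) * (- 1) ^ (q - p) * y ^ p) =
        (- x gchoose p) * (x + of_nat r gchoose (r - p)) * y ^ p"
      by (simp add: mult_ac)
  qed
  finally show ?thesis .
qed

section \<open>Arrays with constant marginals\<close>

text \<open>A signed, real-valued orthogonal array of strength t and index \<open>\<mu>\<close>.
  Marginals on fewer than t coordinates are included so that they can be used directly; for t at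
  most k they follow from those on t coordinates.\<close>

definition has_marginals :: "nat \<Rightarrow> real \<Rightarrow> ('s::finite ^ 'k::finite \<Rightarrow> real) \<Rightarrow> bool" where
  "has_marginals t \<mu> N \<longleftrightarrow>
     (\<forall>A u. card A \<le> t \<longrightarrow>
        (\<Sum>y | \<forall>i\<in>A. y $ i = u $ i. N y) = \<mu> * real CARD('s) ^ (t - card A))"

lemma has_marginals_add:
  assumes "has_marginals t \<mu> M" "has_marginals t \<nu> N"
  shows "has_marginals t (\<mu> + \<nu>) (\<lambda>y. M y + N y)"
  using assms by (simp add: has_marginals_def sum.distrib distrib_right)

lemma has_marginals_cmult:
  assumes "has_marginals t \<mu> N"
  shows "has_marginals t (c * \<mu>) (\<lambda>y. c * N y)"
  using assms by (simp add: has_marginals_def flip: sum_distrib_left)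

lemma has_marginals_sum_zero:
  assumes "\<And>j. j \<in> J \<Longrightarrow> has_marginals t 0 (N j)"
  shows "has_marginals t 0 (\<lambda>y. \<Sum>j\<in>J. N j y)"
  using assms by (auto simp: has_marginals_def intro: sum.neutral simp: sum.swap[of _ J])

text \<open>Prescribing some coordinates cuts out a product set, so the sum of a product factors
  coordinatewise.\<close>

lemma sum_words_prod:
  fixes f :: "'k::finite \<Rightarrow> 's::finite \<Rightarrow> real"
  shows "(\<Sum>y | \<forall>i\<in>A. y $ i = u $ i. \<Prod>i\<in>UNIV. f i (y $ i)) =
         (\<Prod>i\<in>UNIV. if i \<in> A then f i (u $ i) else (\<Sum>x\<in>UNIV. f i x))"
proof -
  define B where "B i = (if i \<in> A then {u $ i} else UNIV)" for i
  have "(\<Sum>y | \<forall>i\<in>A. y $ i = u $ i. \<Prod>i\<in>UNIV. f i (y $ i)) =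
        (\<Sum>g\<in>PiE UNIV B. \<Prod>i\<in>UNIV. f i (g i))"
    by (rule sum.reindex_bij_witness[of _ vec_lambda vec_nth])
       (auto simp: B_def PiE_def Pi_def split: if_splits)
  also have "\<dots> = (\<Prod>i\<in>UNIV. \<Sum>x\<in>B i. f i x)"
    by (rule prod_sum_PiE[symmetric]) auto
  finally show ?thesis
    by (auto simp: B_def intro!: prod.cong elim!: trans)
qed

lemma has_marginals_uniform:
  assumes "t \<le> CARD('k)"
  shows "has_marginals t (real CARD('s) ^ (CARD('k) - t)) (\<lambda>y :: 's::finite ^ 'k::finite. 1)"
proof -
  have "(\<Sum>y :: 's ^ 'k | \<forall>i\<in>A. y $ i = u $ i. 1) = real CARD('s) ^ (CARD('k) - t) * real CARD('s) ^ (t - card A)"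
    if "card A \<le> t" for A and u :: "'s ^ 'k"
  proof -
    have "(\<Sum>y :: 's ^ 'k | \<forall>i\<in>A. y $ i = u $ i. 1) = (\<Prod>i\<in>UNIV. if i \<in> A then 1 else real CARD('s))"
      using sum_words_prod[of "\<lambda>_ _. 1" A u] by (simp cong: if_cong)
    also have "\<dots> = real CARD('s) ^ card (- A)"
      by (simp add: prod.If_cases Collect_neg_eq)
    also have "card (- A) = (CARD('k) - t) + (t - card A)"
      using assms that by (simp add: card_Diff_subset Compl_eq_Diff_UNIV)
    finally show ?thesis by (simp add: power_add)
  qed
  then show ?thesis by (simp add: has_marginals_def)
qed

section \<open>Product contrasts and arrays with zero marginals\<close>

definition contrast :: "'k set \<Rightarrow> 's::finite ^ 'k::finite \<Rightarrow> 's ^ 'k \<Rightarrow> real" where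
  "contrast T u v = (\<Prod>i\<in>T. if v $ i = u $ i then 1 else - 1 / (real CARD('s) - 1))"

text \<open>A set A of at most t coordinates misses some i in T. The factor at i sums to 1 - (s - 1)
  / (s - 1) = 0 over the alphabet, which kills the marginal on A.\<close>

lemma has_marginals_contrast:
  fixes u :: "'s::finite ^ 'k::finite"
  assumes "t < card T" "CARD('s) \<ge> 2"
  shows "has_marginals t 0 (contrast T u)"
proof -
  define g where
    "g i x = (if i \<in> T then (if x = u $ i then 1 else - 1 / (real CARD('s) - 1)) else 1)" for i x
  have g: "contrast T u v = (\<Prod>i\<in>UNIV. g i (v $ i))" for v
    unfolding contrast_def g_def by (simp add: prod.If_cases)
  have "(\<Sum>y | \<forall>i\<in>A. y $ i = w $ i. contrast T u y) = 0" if "card A \<le> t" for A w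
  proof -
    have "\<not> T \<subseteq> A" using assms that card_mono[of A T] by auto
    then obtain i where i: "i \<in> T" "i \<notin> A" by auto
    have "(\<Sum>x\<in>UNIV. g i x) = g i (u $ i) + (\<Sum>x\<in>UNIV - {u $ i}. g i x)"
      by (subst sum.remove[of _ "u $ i"]) auto
    also have "(\<Sum>x\<in>UNIV - {u $ i}. g i x) = (\<Sum>x\<in>UNIV - {u $ i}. - 1 / (real CARD('s) - 1))"
      using i by (intro sum.cong) (auto simp: g_def)
    also have "\<dots> = - 1"
      using assms by (simp add: card_Diff_singleton field_simps)
    finally have "(\<Sum>x\<in>UNIV. g i x) = 0" using i by (simp add: g_def)
    then show ?thesis
      unfolding g sum_words_prod using i by (intro prod_zero) auto
  qed
  then show ?thesis by (simp add: has_marginals_def)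
qed

lemma contrast_self [simp]: "contrast T u u = 1"
  by (simp add: contrast_def)

lemma abs_contrast_le:
  fixes u :: "'s::finite ^ 'k::finite"
  assumes "CARD('s) \<ge> 2"
  shows "\<bar>contrast T u v\<bar> \<le> 1"
  unfolding contrast_def abs_prod
  using assms by (intro prod_le_1) (auto simp: abs_if field_simps)

text \<open>A mismatched coordinate contributes 1 / (s - 1) in absolute value, which is below 1 once
  s is at least 3. For s = 2 contrasts take only the values 1 and -1.\<close>

lemma abs_contrast_less:
  fixes u :: "'s::finite ^ 'k::finite"
  assumes "CARD('s) \<ge> 3" "i \<in> T" "v $ i \<noteq> u $ i"
  shows "\<bar>contrast T u v\<bar> < 1"
proof -
  have "contrast T u v = - 1 / (real CARD('s) - 1) * contrast (T - {i}) u v"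
    using assms prod.remove[of T i "\<lambda>i. if v $ i = u $ i then 1 else - 1 / (real CARD('s) - 1)"]
    by (simp add: contrast_def)
  then have "\<bar>contrast T u v\<bar> = 1 / (real CARD('s) - 1) * \<bar>contrast (T - {i}) u v\<bar>"
    using assms by (simp add: abs_mult)
  also have "\<dots> \<le> 1 / (real CARD('s) - 1) * 1"
    using assms by (intro mult_left_mono abs_contrast_le) auto
  also have "\<dots> < 1" using assms by (simp add: field_simps)
  finally show ?thesis .
qed

text \<open>The minimum is normalised to -1 at u so that c * (1 + z) is nonnegative and vanishes at
  u. If k = t + 1 and s = 2, the full contrast is (-1)^d at distance d from u, so the minimum recurs
  at every even distance.\<close>

lemma exists_zero_marginals:
  fixes u :: "'s::finite ^ 'k::finite"
  assumes t: "t < CARD('k)" and s: "CARD('s) \<ge> 2"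
  obtains z where "has_marginals t 0 z" "z u = -1" "\<And>v. z v \<ge> -1"
    "\<And>v. \<lbrakk>v \<noteq> u; \<not> (CARD('k) = t + 1 \<and> CARD('s) = 2)\<rbrakk> \<Longrightarrow> z v > -1"
proof (cases "CARD('k) = t + 1")
  case True
  \<comment> \<open>Here \<open>UNIV\<close> is the only set of more than t coordinates, hence the
    only one whose contrast is available.\<close>
  show thesis
  proof (rule that[of "\<lambda>v. - 1 * contrast UNIV u v"])
    show "has_marginals t 0 (\<lambda>v. - 1 * contrast UNIV u v)"
      using has_marginals_cmult[OF has_marginals_contrast[OF _ s], of t UNIV "- 1"] t by simp
    show "- 1 * contrast UNIV u v \<ge> - 1" for v
      using abs_contrast_le[OF s, of UNIV u v] by (simp add: abs_le_iff)
    show "- 1 * contrast UNIV u v > - 1"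
      if "v \<noteq> u" "\<not> (CARD('k) = t + 1 \<and> CARD('s) = 2)" for v
    proof -
      obtain i where "v $ i \<noteq> u $ i" using \<open>v \<noteq> u\<close> by (auto simp: vec_eq_iff)
      then show ?thesis
        using abs_contrast_less[of i UNIV v u] that s True by (simp add: abs_less_iff)
    qed
  qed auto
next
  case False
  define S where "S v = contrast UNIV u v + (\<Sum>i\<in>UNIV. contrast (- {i}) u v)" for v
  \<comment> \<open>The number of contrasts in \<open>S\<close>, hence the value of \<open>S\<close>
    at u.\<close>
  define c where "c = real CARD('k) + 1"
  have c: "c > 0" by (simp add: c_def)
  have le: "contrast T u v \<le> 1" for T v
    using abs_contrast_le[OF s, of T u v] by (simp add: abs_le_iff)
  have sum_le: "(\<Sum>i\<in>UNIV. contrast (- {i}) u v) \<le> real CARD('k)" for v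
    using sum_mono[of UNIV "\<lambda>i. contrast (- {i}) u v" "\<lambda>_. 1"] le by simp
  have S_le: "S v \<le> c" for v
    using sum_le[of v] le[of UNIV v] by (simp add: S_def c_def)
  \<comment> \<open>If \<open>v\<close> and \<open>u\<close> differ at \<open>i\<close>, the contrasts over \<open>[k]\<close> and \<open>[k] - {i}\<close> cannot both be \<open>1\<close>,
    since their quotient is \<open>- 1 / (s - 1)\<close>.\<close>
  have S_less: "S v < c" if "v \<noteq> u" for v
  proof -
    obtain i where i: "v $ i \<noteq> u $ i" using \<open>v \<noteq> u\<close> by (auto simp: vec_eq_iff)
    have rel: "contrast UNIV u v = - 1 / (real CARD('s) - 1) * contrast (- {i}) u v"
      using i prod.remove[of UNIV i "\<lambda>i. if v $ i = u $ i then 1 else - 1 / (real CARD('s) - 1)"]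
      by (simp add: contrast_def Compl_eq_Diff_UNIV)
    show ?thesis
    proof (cases "contrast (- {i}) u v = 1")
      case True
      then have "contrast UNIV u v < 0" using rel s by simp
      then show ?thesis using sum_le[of v] by (simp add: S_def c_def)
    next
      case False
      then have "(\<Sum>i\<in>UNIV. contrast (- {i}) u v) < (\<Sum>i\<in>(UNIV::'k set). 1)"
        using le by (intro sum_strict_mono_ex1) (auto simp: less_le)
      then show ?thesis using le[of UNIV v] by (simp add: S_def c_def)
    qed
  qed
  show thesis
  proof (rule that[of "\<lambda>v. - 1 / c * S v"])
    have "has_marginals t 0 (\<lambda>v. \<Sum>i\<in>UNIV. contrast (- {i}) u v)"
      using t s False by (intro has_marginals_sum_zero has_marginals_contrast) (auto simp: card_Diff_subset Compl_eq_Diff_UNIV)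
    then have "has_marginals t (0 + 0) S"
      unfolding S_def using t s by (intro has_marginals_add has_marginals_contrast) auto
    then show "has_marginals t 0 (\<lambda>v. - 1 / c * S v)"
      using has_marginals_cmult[of t 0 S "- 1 / c"] by simp
    have "S u = c" by (simp add: S_def c_def)
    then show "- 1 / c * S u = - 1" using c by simp
    show "- 1 / c * S v \<ge> - 1" for v
      using S_le[of v] c by (simp add: field_simps)
    show "- 1 / c * S v > - 1" if "v \<noteq> u" for v
      using S_less[OF that] c by (simp add: field_simps)
  qed
qed

section \<open>The inequalities evaluated at arrays\<close>

lemma hamming_one: "hamming 1 y = card (supp_set y)"
  unfolding hamming_def supp_set_def by (rule arg_cong[where f = card]) auto

lemma hamming_le: "hamming (u :: 's ^ 'k::finite) v \<le> CARD('k)"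
  unfolding hamming_def by (rule card_mono) auto

lemma ext_set_mono: "y \<in> ext_set u \<Longrightarrow> supp_set u \<subseteq> supp_set y"
  by (auto simp: ext_set_def supp_set_def)

lemma ext_set_eqI:
  fixes u :: "'s::one ^ 'k::finite"
  assumes "y \<in> ext_set u" "hamming 1 y \<le> hamming 1 u"
  shows "y = u"
proof -
  have "supp_set u = supp_set y"
    using assms ext_set_mono[OF assms(1)] by (intro card_seteq) (auto simp: hamming_one)
  then show ?thesis
    using assms(1) by (auto simp: vec_eq_iff ext_set_def supp_set_def)
qed

text \<open>Double counting: the binomial counts the q-sets S of positions where y is 1, all
  disjoint from the support of u. For fixed S, the words y are those agreeing with u on
  \<open>supp_set u \<union> S\<close>, so their sum is a marginal on \<open>hamming 1 u + q\<close>
  coordinates.\<close>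

lemma sum_ext_set_choose:
  fixes N :: "'s::{finite,one} ^ 'k::finite \<Rightarrow> real"
  assumes N: "has_marginals t \<mu> N" and q: "hamming 1 u + q \<le> t"
  shows "(\<Sum>y\<in>ext_set u. real ((CARD('k) - hamming 1 y) choose q) * N y) =
         real ((CARD('k) - hamming 1 u) choose q) * (\<mu> * real CARD('s) ^ (t - hamming 1 u - q))"
proof -
  let ?P = "\<lambda>S y. S \<subseteq> - supp_set y \<and> card S = q"
  have card: "card {S. ?P S y} = (CARD('k) - hamming 1 y) choose q" for y :: "'s ^ 'k"
    using n_subsets[of "- supp_set y" q] by (simp add: card_Diff_subset Compl_eq_Diff_UNIV hamming_one)
  have "(\<Sum>y\<in>ext_set u. real ((CARD('k) - hamming 1 y) choose q) * N y) =
        (\<Sum>y\<in>ext_set u. \<Sum>S | S \<in> {S. ?P S u} \<and> S \<subseteq> - supp_set y. N y)"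
  proof (intro sum.cong refl)
    fix y assume "y \<in> ext_set u"
    then have "{S. S \<in> {S. ?P S u} \<and> S \<subseteq> - supp_set y} = {S. ?P S y}"
      using ext_set_mono by blast
    then show "real ((CARD('k) - hamming 1 y) choose q) * N y =
        (\<Sum>S | S \<in> {S. ?P S u} \<and> S \<subseteq> - supp_set y. N y)"
      using card[of y] by simp
  qed
  also have "\<dots> = (\<Sum>S | ?P S u. \<Sum>y | y \<in> ext_set u \<and> S \<subseteq> - supp_set y. N y)"
    by (rule sum.swap_restrict) auto
  also have "\<dots> = (\<Sum>S | ?P S u. \<mu> * real CARD('s) ^ (t - hamming 1 u - q))"
  proof (intro sum.cong refl)
    fix S assume "S \<in> {S. ?P S u}"
    then have S: "S \<inter> supp_set u = {}" "card S = q" by auto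
    then have c: "card (supp_set u \<union> S) = hamming 1 u + q"
      by (simp add: card_Un_disjoint hamming_one Int_commute)
    have "{y. y \<in> ext_set u \<and> S \<subseteq> - supp_set y} = {y. \<forall>i\<in>supp_set u \<union> S. y $ i = u $ i}"
      using S by (auto simp: ext_set_def supp_set_def)
    then show "(\<Sum>y | y \<in> ext_set u \<and> S \<subseteq> - supp_set y. N y) = \<mu> * real CARD('s) ^ (t - hamming 1 u - q)"
      using N q c by (simp add: has_marginals_def diff_diff_add)
  qed
  also have "\<dots> = real ((CARD('k) - hamming 1 u) choose q) * (\<mu> * real CARD('s) ^ (t - hamming 1 u - q))"
    using card[of u] by simp
  finally show ?thesis .
qed

definition restrict_array :: "nat \<Rightarrow> ('s::{finite,one} ^ 'k::finite \<Rightarrow> real) \<Rightarrow> real ^ ('s ^ 'k)" where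
  "restrict_array t N = (\<chi> y. if hamming 1 y > t then N y else 0)"

lemma restrict_array_in_oa_space: "restrict_array t N \<in> oa_space t"
  by (auto simp: restrict_array_def oa_space_def)

text \<open>Inclusion-exclusion: the sum of \<open>w y * N y\<close> over \<open>ext_set u\<close>
  is computed twice. The marginals give the coefficient \<open>oa_coeff\<close>; pointwise, only u
  itself and the words beyond distance t contribute.\<close>

lemma oa_lhs_restrict_array:
  fixes u :: "'s::{finite,one} ^ 'k::finite"
  assumes N: "has_marginals t (real lam) N" and t: "t \<le> CARD('k)"
  shows "oa_lhs t lam u (restrict_array t N) = N u"
proof (cases "hamming 1 u > t")
  case True
  then show ?thesis by (simp add: oa_lhs_def restrict_array_def)
next
  case False
  define d where "d = hamming 1 u"
  define r where "r = t - d"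
  define K where "K = real (CARD('k) - t)"
  \<comment> \<open>A polynomial in the distance of y from 1 that vanishes at distances d + 1 to t.
    The real upper index matters: at y = u it is -1, which gives weight 1, whereas natural
    subtraction would truncate.\<close>
  define w where "w y = (- 1) ^ r * ((real (hamming 1 y) - real d - 1) gchoose r)" for y :: "'s ^ 'k"
  have d: "d \<le> t" using False by (simp add: d_def)
  have Kr: "real (CARD('k) - d) = K + real r" using d t by (simp add: K_def r_def)
  \<comment> \<open>Upper negation changes the upper index to (k - \<open>hamming 1 y\<close>) - K,
    and Vandermonde then expands the weight in the binomials that \<open>sum_ext_set_choose\<close>
    handles.\<close>
  have w_exp: "w y = (\<Sum>q\<le>r. real ((CARD('k) - hamming 1 y) choose q) * (- K gchoose (r - q)))"
    for y
  proof -
    have "w y = (real r - (real (hamming 1 y) - real d) gchoose r)"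
      unfolding w_def by (subst (2) gbinomial_negated_upper) (simp add: algebra_simps)
    also have "real r - (real (hamming 1 y) - real d) = real (CARD('k) - hamming 1 y) + - K"
      using d t hamming_le[of 1 y] by (simp add: r_def K_def)
    finally show ?thesis
      by (simp only: binomial_gbinomial atMost_atLeast0 gbinomial_Vandermonde)
  qed
  have "(\<Sum>y\<in>ext_set u. w y * N y) =
        (\<Sum>q\<le>r. (- K gchoose (r - q)) * (\<Sum>y\<in>ext_set u. real ((CARD('k) - hamming 1 y) choose q) * N y))"
    unfolding w_exp sum_distrib_left sum_distrib_right
    by (subst sum.swap) (simp add: mult_ac)
  also have "\<dots> = (\<Sum>q\<le>r. (- K gchoose (r - q)) *
      (real ((CARD('k) - d) choose q) * (real lam * real CARD('s) ^ (r - q))))"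
    using sum_ext_set_choose[OF N, of u] d
    by (intro sum.cong) (auto simp: d_def r_def)
  also have "\<dots> = real lam *
      (\<Sum>q\<le>r. (- K gchoose (r - q)) * (K + real r gchoose q) * real CARD('s) ^ (r - q))"
    by (simp add: sum_distrib_left binomial_gbinomial Kr mult_ac)
  also have "(\<Sum>q\<le>r. (- K gchoose (r - q)) * (K + real r gchoose q) * real CARD('s) ^ (r - q)) =
      (\<Sum>p\<le>r. (- K gchoose p) * (K + real r gchoose (r - p)) * real CARD('s) ^ p)"
    by (rule sum.reindex_bij_witness[of _ "\<lambda>p. r - p" "\<lambda>p. r - p"]) auto
  also have "real lam * \<dots> = oa_coeff CARD('k) CARD('s) t lam r"
    by (simp add: oa_coeff_closed_form gbinomial_partial_sum_shift K_def)
  finally have total: "(\<Sum>y\<in>ext_set u. w y * N y) = oa_coeff CARD('k) CARD('s) t lam r" .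

  have w_u: "w u = 1"
    by (simp add: w_def d_def gbinomial_minus[of 1, simplified] flip: power_add binomial_gbinomial)
  have w_zero: "w y = 0" if "y \<in> ext_set u" "y \<noteq> u" "hamming 1 y \<le> t" for y
  proof -
    have "d < hamming 1 y" using ext_set_eqI[of y u] that by (force simp: d_def)
    then have "w y = (- 1) ^ r * (real (hamming 1 y - d - 1) gchoose r)"
      by (simp add: w_def diff_diff_eq add.commute)
    also have "\<dots> = 0"
      unfolding binomial_gbinomial[symmetric] using that \<open>d < hamming 1 y\<close> by (simp add: r_def)
    finally show ?thesis .
  qed
  have w_far: "w y = (- 1) ^ r * real ((hamming 1 y - d - 1) choose r)" if "hamming 1 y > t" for y
    using that d by (simp add: w_def binomial_gbinomial diff_diff_eq add.commute)
  have u: "u \<in> ext_set u" by (simp add: ext_set_def)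
  have "(\<Sum>y\<in>ext_set u. w y * N y) = (\<Sum>y\<in>insert u {y \<in> ext_set u. hamming 1 y > t}. w y * N y)"
    using u w_zero by (intro sum.mono_neutral_right) (auto simp flip: not_le)
  also have "\<dots> = N u + (\<Sum>y\<in>{y \<in> ext_set u. hamming 1 y > t}. w y * N y)"
    using False by (subst sum.insert) (auto simp: w_u)
  also have "(\<Sum>y\<in>{y \<in> ext_set u. hamming 1 y > t}. w y * N y) =
      (- 1) ^ r * (\<Sum>y\<in>{y \<in> ext_set u. hamming 1 y > t}.
          real ((hamming 1 y - d - 1) choose r) * restrict_array t N $ y)"
    by (simp add: sum_distrib_left w_far restrict_array_def mult_ac)
  finally show ?thesis
    using False total by (simp add: oa_lhs_def d_def r_def)
qed

section \<open>Facets\<close>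

lemma oa_lhs_affine:
  fixes u :: "'s::{finite,one} ^ 'k::finite"
  obtains a b where "\<And>N. oa_lhs t lam u N = a \<bullet> N + b"
proof (cases "hamming 1 u > t")
  case True
  show thesis
    by (rule that[of "axis u 1" 0]) (use True in \<open>simp add: oa_lhs_def inner_axis'\<close>)
next
  case False
  define E where "E = {y \<in> ext_set u. hamming 1 y > t}"
  define c where "c y = (- 1) ^ (t - hamming 1 u + 1) *
     real ((hamming 1 y - hamming 1 u - 1) choose (t - hamming 1 u))" for y :: "'s ^ 'k"
  show thesis
  proof (rule that)
    fix N
    have "(\<chi> y. if y \<in> E then c y else 0) \<bullet> N = (\<Sum>y\<in>UNIV. if y \<in> E then c y * N $ y else 0)"
      unfolding inner_vec_def by (intro sum.cong) auto
    also have "\<dots> = (\<Sum>y\<in>E. c y * N $ y)" by (simp add: sum.If_cases)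
    finally show "oa_lhs t lam u N = (\<chi> y. if y \<in> E then c y else 0) \<bullet> N
        + oa_coeff CARD('k) CARD('s) t lam (t - hamming 1 u)"
      using False by (simp add: oa_lhs_def E_def c_def sum_distrib_left mult.assoc)
  qed
qed

lemma subspace_oa_space: "subspace (oa_space t)"
  by (auto simp: subspace_def oa_space_def)

text \<open>Bounds the dimension of the polytope by 0 or 1 in the degenerate cases t = k, and k = t
  + 1 with s = 2.\<close>

lemma dim_oa_space_le:
  "dim (oa_space t :: (real ^ ('s::{finite,one} ^ 'k::finite)) set) \<le>
   card {y :: 's ^ 'k. hamming 1 y > t}"
proof -
  define B where "B = (\<lambda>y :: 's ^ 'k. axis y 1 :: real ^ ('s ^ 'k)) ` {y. hamming 1 y > t}"
  have "N \<in> span B" if "N \<in> oa_space t" for N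
  proof -
    have "N = (\<Sum>y\<in>UNIV. N $ y *\<^sub>R axis y 1)"
      using basis_expansion[of N] by (simp add: scalar_mult_eq_scaleR)
    also have "\<dots> \<in> span B"
    proof (rule span_sum)
      fix y :: "'s ^ 'k"
      show "N $ y *\<^sub>R axis y 1 \<in> span B"
        using that by (cases "hamming 1 y > t")
          (auto simp: B_def oa_space_def intro: span_scale span_base span_zero)
    qed
    finally show ?thesis .
  qed
  then have "dim (oa_space t :: (real ^ ('s ^ 'k)) set) \<le> card B"
    by (intro dim_le_card) (auto simp: B_def)
  also have "\<dots> \<le> card {y :: 's ^ 'k. hamming 1 y > t}"
    unfolding B_def by (rule card_image_le) simp
  finally show ?thesis .
qed

text \<open>Near \<open>x0\<close> the polyhedron fills X, and near \<open>x1\<close> the face fills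
  the hyperplane section of X. A convex set keeps its affine dimension when cut by an open set that
  meets it.\<close>

lemma is_facet_of_polyhedron:
  fixes a :: "'i::finite \<Rightarrow> 'a::euclidean_space"
  assumes X: "affine X"
    and P: "P = {x \<in> X. \<forall>v. a v \<bullet> x + b v \<ge> 0}"
    and x0: "x0 \<in> X" "\<And>v. a v \<bullet> x0 + b v > 0"
    and x1: "x1 \<in> X" "a u \<bullet> x1 + b u = 0" "\<And>v. v \<noteq> u \<Longrightarrow> a v \<bullet> x1 + b v > 0"
    and F: "F face_of P" "F = {x \<in> P. a u \<bullet> x + b u = 0}"
  shows "is_facet_of F P"
proof -
  define H where "H = {x. a u \<bullet> x = - b u}"
  define T where "T V = (\<Inter>v\<in>V. {x. a v \<bullet> x + b v > 0})" for V
  have T: "open (T V)" for V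
    unfolding T_def by (intro open_INT ballI open_Collect_less continuous_intros) auto
  \<comment> \<open>\<open>x0\<close> off the hyperplane and \<open>x1\<close> on it exclude the
    cases where X lies inside H or misses it.\<close>
  have XH: "aff_dim (X \<inter> H) = aff_dim X - 1"
    using aff_dim_affine_Int_hyperplane[OF X, of "a u" "- b u"] x0(1) x0(2)[of u] x1(1,2)
    by (force simp: H_def)
  have "aff_dim X = aff_dim (X \<inter> T UNIV)"
    using x0 by (intro aff_dim_convex_Int_open[symmetric] affine_imp_convex X T) (auto simp: T_def)
  also have "\<dots> \<le> aff_dim P"
    by (rule aff_dim_subset) (auto simp: P T_def intro: less_imp_le)
  finally have dimP: "aff_dim P = aff_dim X"
    using aff_dim_subset[of P X] by (auto simp: P)
  have "x1 \<in> X \<inter> H \<inter> T (- {u})" using x1 by (auto simp: H_def T_def)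
  then have "aff_dim (X \<inter> H) = aff_dim (X \<inter> H \<inter> T (- {u}))"
    using X by (intro aff_dim_convex_Int_open[symmetric] T convex_Int affine_imp_convex)
      (auto simp: H_def affine_hyperplane)
  also have "\<dots> \<le> aff_dim F"
  proof (rule aff_dim_subset, rule subsetI)
    fix x assume x: "x \<in> X \<inter> H \<inter> T (- {u})"
    then have "a v \<bullet> x + b v \<ge> 0" for v
      by (cases "v = u") (auto simp: H_def T_def less_imp_le)
    then show "x \<in> F" using x by (auto simp: F(2) P H_def)
  qed
  finally have "aff_dim F = aff_dim (X \<inter> H)"
    using aff_dim_subset[of F "X \<inter> H"] by (force simp: F(2) P H_def eq_neg_iff_add_eq_0)
  then show ?thesis using F XH dimP by (simp add: is_facet_of_def)
qed

theorem theorem5: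
  fixes k s t lam :: nat
  assumes "CARD('k::finite) = k" and "CARD('s::{finite,one}) = s"
    and "s \<ge> 2" and "k \<ge> 1" and "t \<le> k" and "lam \<ge> 1"
  shows "(\<forall>u :: 's ^ 'k. is_facet_of (OAP_face t lam u) (OAP t lam)) \<and>
         (t < k \<and> \<not> (k = t + 1 \<and> s = 2) \<longrightarrow>
            (\<forall>u v :: 's ^ 'k. u \<noteq> v \<longrightarrow> OAP_face t lam u \<noteq> OAP_face t lam v))"
proof -
  let ?P = "OAP t lam :: (real ^ ('s ^ 'k)) set"
  \<comment> \<open>The constant entry of the uniform array of index lam.\<close>
  define c where "c = real lam / real s ^ (k - t)"
  have c: "c > 0" using assms by (simp add: c_def)
  have uniform: "has_marginals t (real lam) (\<lambda>y :: 's ^ 'k. c)"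
    using has_marginals_cmult[OF has_marginals_uniform[where 's = 's and 'k = 'k], of t c] assms
    by (simp add: c_def)
  define x0 :: "real ^ ('s ^ 'k)" where "x0 = restrict_array t (\<lambda>_. c)"
  have x0: "x0 \<in> oa_space t" "oa_lhs t lam v x0 = c" for v
    using oa_lhs_restrict_array[OF uniform, of v] assms
    by (auto simp: x0_def restrict_array_in_oa_space)
  have x0P: "x0 \<in> ?P" using x0 c by (auto simp: OAP_def less_imp_le)

  have x1: "\<exists>x1 \<in> oa_space t. oa_lhs t lam u x1 = 0 \<and> (\<forall>v. oa_lhs t lam v x1 \<ge> 0) \<and>
      (\<not> (k = t + 1 \<and> s = 2) \<longrightarrow> (\<forall>v. v \<noteq> u \<longrightarrow> oa_lhs t lam v x1 > 0))"
    if "t < k" for u :: "'s ^ 'k"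
  proof -
    obtain z where z: "has_marginals t 0 z" "z u = -1" "\<And>v. z v \<ge> -1"
      "\<And>v. \<lbrakk>v \<noteq> u; \<not> (k = t + 1 \<and> s = 2)\<rbrakk> \<Longrightarrow> z v > -1"
      using exists_zero_marginals[of t u] \<open>t < k\<close> assms by metis
    \<comment> \<open>Zero marginals of z preserve the index lam, and z u = -1 makes the entry at u
      vanish.\<close>
    define N where "N v = c + c * z v" for v
    have N: "has_marginals t (real lam) N"
      using has_marginals_add[OF uniform has_marginals_cmult[OF z(1), of c]] by (simp add: N_def[abs_def])
    have eq: "N v = c * (1 + z v)" for v by (simp add: N_def algebra_simps)
    show ?thesis
    proof (intro bexI[of _ "restrict_array t N"] conjI impI allI restrict_array_in_oa_space)
      fix v
      show "oa_lhs t lam v (restrict_array t N) \<ge> 0"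
        using oa_lhs_restrict_array[OF N, of v] assms z(3)[of v] c by (simp add: eq)
      show "oa_lhs t lam v (restrict_array t N) > 0" if "\<not> (k = t + 1 \<and> s = 2)" "v \<noteq> u"
        using oa_lhs_restrict_array[OF N, of v] assms z(4)[of v] that c by (simp add: eq)
    qed (use oa_lhs_restrict_array[OF N, of u] assms z(2) in \<open>simp add: eq\<close>)
  qed

  have "\<forall>u :: 's ^ 'k. \<exists>a b. \<forall>N. oa_lhs t lam u N = a \<bullet> N + b"
    using oa_lhs_affine by metis
  then obtain a b where ab: "\<And>(u :: 's ^ 'k) N. oa_lhs t lam u N = a u \<bullet> N + b u"
    by metis
  have P: "?P = {x \<in> oa_space t. \<forall>v. a v \<bullet> x + b v \<ge> 0}"
    by (simp add: OAP_def ab)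
  have affine: "affine (oa_space t :: (real ^ ('s ^ 'k)) set)"
    by (rule subspace_imp_affine[OF subspace_oa_space])
  have "?P = oa_space t \<inter> (\<Inter>v. {x. a v \<bullet> x \<ge> - b v})"
    unfolding P by (auto simp: algebra_simps) (smt (verit))+
  then have convex: "convex ?P"
    using affine by (simp only:) (intro convex_Int convex_INT convex_halfspace_ge affine_imp_convex)

  have facet: "is_facet_of (OAP_face t lam u) ?P" for u
  proof -
    have F: "OAP_face t lam u = {x \<in> ?P. a u \<bullet> x + b u = 0}"
      by (simp add: OAP_face_def ab)
    have "OAP_face t lam u = ?P \<inter> {x. a u \<bullet> x = - b u}"
      unfolding F by auto
    moreover have "a u \<bullet> x \<ge> - b u" if "x \<in> ?P" for x
      using that by (simp add: P) (smt (verit))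
    ultimately have face: "OAP_face t lam u face_of ?P"
      using face_of_Int_supporting_hyperplane_ge[OF convex] by metis
    \<comment> \<open>The face is proper, so its dimension drops by at least one; the degenerate
      cases then only need crude bounds on dimensions.\<close>
    have "x0 \<notin> OAP_face t lam u" using x0(2)[of u] c by (simp add: OAP_face_def)
    then have lt: "aff_dim (OAP_face t lam u) < aff_dim ?P"
      using x0P by (intro face_of_aff_dim_lt convex face) auto
    have "aff_dim ?P \<le> aff_dim (oa_space t :: (real ^ ('s ^ 'k)) set)"
      by (rule aff_dim_subset) (auto simp: OAP_def)
    also have "\<dots> \<le> int (card {y :: 's ^ 'k. hamming 1 y > t})"
      using dim_oa_space_le[of t] by (simp add: aff_dim_subspace[OF subspace_oa_space])
    finally have dim: "aff_dim ?P \<le> int (card {y :: 's ^ 'k. hamming 1 y > t})" .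
    consider "t = k" | "t < k" "k = t + 1" "s = 2" | "t < k" "\<not> (k = t + 1 \<and> s = 2)"
      using assms by linarith
    then show ?thesis
    proof cases
      case 1
      then have empty: "{y :: 's ^ 'k. hamming 1 y > t} = {}"
        using hamming_le[of "1 :: 's ^ 'k"] assms(1) by (auto simp: not_less)
      \<comment> \<open>The polytope is a single point and the face is empty, of dimension
        -1.\<close>
      have "aff_dim ?P \<le> 0" using dim unfolding empty by simp
      then show ?thesis
        using lt face aff_dim_geq[of "OAP_face t lam u"] by (simp add: is_facet_of_def)
    next
      case 2
      have full: "y $ i \<noteq> 1" if "hamming 1 y > t" for y :: "'s ^ 'k" and i
      proof -
        have "supp_set y = UNIV"
          using that 2 assms(1) by (intro card_seteq) (auto simp: hamming_one)
        then show ?thesis by (auto simp: supp_set_def)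
      qed
      have "card (UNIV - {1 :: 's}) = 1" using 2 assms by (simp add: card_Diff_singleton)
      then obtain e where e: "UNIV - {1 :: 's} = {e}" by (rule card_1_singletonE)
      have "y = (\<chi> i. e)" if "hamming 1 y > t" for y :: "'s ^ 'k"
        using full[OF that] e by (auto simp: vec_eq_iff)
      then have "{y :: 's ^ 'k. hamming 1 y > t} \<subseteq> {\<chi> i. e}" by blast
      from card_mono[OF _ this] have "aff_dim ?P \<le> 1" using dim by simp
      \<comment> \<open>A nonempty proper face of a polytope of dimension at most 1 forces the
        dimensions 0 and 1.\<close>
      moreover have "OAP_face t lam u \<noteq> {}"
        using x1[OF 2(1), of u] by (auto simp: OAP_face_def OAP_def)
      then have "aff_dim (OAP_face t lam u) \<ge> 0"
        using aff_dim_geq[of "OAP_face t lam u"] aff_dim_empty[of "OAP_face t lam u"] by linarith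
      ultimately show ?thesis using lt face by (simp add: is_facet_of_def)
    next
      case 3
      obtain y where "y \<in> oa_space t" "oa_lhs t lam u y = 0" "\<And>v. v \<noteq> u \<Longrightarrow> oa_lhs t lam v y > 0"
        using x1[OF 3(1), of u] 3(2) by blast
      then show ?thesis
        using x0 c by (intro is_facet_of_polyhedron[OF affine P, of x0 y u] face F) (auto simp flip: ab)
    qed
  qed
  moreover have "OAP_face t lam u \<noteq> OAP_face t lam v"
    if *: "t < k" "\<not> (k = t + 1 \<and> s = 2)" "u \<noteq> v" for u v :: "'s ^ 'k"
  proof -
    \<comment> \<open>The point tight only at u separates the two faces.\<close>
    obtain y where "y \<in> oa_space t" "oa_lhs t lam u y = 0" "\<And>w. oa_lhs t lam w y \<ge> 0"
      "oa_lhs t lam v y > 0"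
      using x1[OF *(1), of u] * by metis
    then have "y \<in> OAP_face t lam u" "y \<notin> OAP_face t lam v"
      by (auto simp: OAP_face_def OAP_def)
    then show ?thesis by blast
  qed
  ultimately show ?thesis by blast
qed

end
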